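(* Let $X$ be a connected compact complex Kähler manifold, let $\omega$ be a closed real $(1,1)$-current on $X$ with continuous local potentials, and let $f:X\to X$ be a surjective holomorphic map. Assume that there exist real numbers $\alpha$ and $\beta$ with $1<\alpha\leq\beta$ such that $$\alpha f_*(PSH(X,\omega))\subset PSH(X,\omega)\quad\text{and}\quad f^*(PSH(X,\omega))\subset \beta\cdot PSH(X,\omega).$$ Then for every Borel set $K\subset X$, every mild function $Q$ on $X$ and every $x\in X$, $$\alpha\, V_{f^{-1}(K),\omega,f^*Q/\alpha}(x)\ \leq\ V_{K,\omega,Q}(f(x))\ \leq\ \beta\, V_{f^{-1}(K),\omega,f^*Q/\beta}(x).$$
   Context: Let $\{U_j\}$ be a finite open cover of $X$ by coordinate neighborhoods on which $\omega=dd^c\phi_j$ with $\phi_j:U_j\to\mathbb{R}$ continuous (local potentials). $PSH(X,\omega)$ is the set of upper semicontinuous functions $v\in L^1(X,\mathbb{R}\cup\{-\infty\})$ with $dd^cv\geq-\omega$ in the sense of currents. A mild function is a function $Q:X\to\mathbb{R}\cup\{+\infty\}$ such that $\exp(-Q+\phi_j)$ is continuous in $U_j$ for every $j$ and $\{Q\neq+\infty\}$ is not a pluripolar subset of $X$. For a Borel set $K\subset X$ and a function $Q:X\to\mathbb{R}\cup\{+\infty\}$, the weighted $\omega$-pluricomplex Green function is $$V_{K,\omega,Q}(x)=\sup\{\phi(x):\phi\in PSH(X,\omega),\ \phi\leq Q\text{ on }K\}.$$ For $u:X\to\mathbb{R}\cup\{-\infty\}$ put $f_*u(x)=\sup\{u(y):y\in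 f^{-1}(x)\}$; for a function $u$ on $X$ put $f^*u=u\circ f$. Also $\alpha f_*(PSH(X,\omega))=\{\alpha f_*u:u\in PSH(X,\omega)\}$, $f^*(PSH(X,\omega))=\{f^*u:u\in PSH(X,\omega)\}$ and $\beta\cdot PSH(X,\omega)=\{\beta u:u\in PSH(X,\omega)\}$. *)

theory Defs
  imports "HOL-Analysis.Analysis"
begin

section \<open>Smooth functions, distributions and holomorphic maps on open subsets of vector spaces\<close>

definition iter_deriv ::
    "'e::real_normed_vector list \<Rightarrow> ('e \<Rightarrow> 'b::real_normed_vector) \<Rightarrow> 'e \<Rightarrow> 'b" where
  "iter_deriv vs g = foldr (\<lambda>v g x. frechet_derivative g (at x) v) vs g"

text \<open>For an open set \<open>S\<close>, infinite differentiability: all iterated directional derivatives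
  exist and are differentiable.\<close>

definition smooth_on ::
    "'e::real_normed_vector set \<Rightarrow> ('e \<Rightarrow> 'b::real_normed_vector) \<Rightarrow> bool" where
  "smooth_on S g \<longleftrightarrow> (\<forall>vs. iter_deriv vs g differentiable_on S)"

definition test_fun :: "'e::euclidean_space set \<Rightarrow> ('e \<Rightarrow> complex) \<Rightarrow> bool" where
  "test_fun S \<theta> \<longleftrightarrow>
     smooth_on UNIV \<theta> \<and> (\<exists>L. compact L \<and> L \<subseteq> S \<and> (\<forall>x. x \<notin> L \<longrightarrow> \<theta> x = 0))"

text \<open>The last conjunct is continuity for the usual topology on test functions: on the test
  functions supported in a fixed compact set, the functional is bounded by a \<open>C\<^sup>N\<close>-norm.\<close>

definition distribution_on ::
    "'e::euclidean_space set \<Rightarrow> (('e \<Rightarrow> complex) \<Rightarrow> complex) \<Rightarrow> bool" where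
  "distribution_on S T \<longleftrightarrow>
     (\<forall>\<theta> \<eta>. test_fun S \<theta> \<longrightarrow> test_fun S \<eta> \<longrightarrow> T (\<lambda>x. \<theta> x + \<eta> x) = T \<theta> + T \<eta>) \<and>
     (\<forall>\<theta> a. test_fun S \<theta> \<longrightarrow> T (\<lambda>x. a * \<theta> x) = a * T \<theta>) \<and>
     (\<forall>L. compact L \<longrightarrow> L \<subseteq> S \<longrightarrow>
        (\<exists>C N. \<forall>\<theta> M. test_fun S \<theta> \<longrightarrow> (\<forall>x. x \<notin> L \<longrightarrow> \<theta> x = 0) \<longrightarrow>
           (\<forall>vs x. set vs \<subseteq> Basis \<longrightarrow> length vs \<le> N \<longrightarrow> norm (iter_deriv vs \<theta> x) \<le> M) \<longrightarrow>
           norm (T \<theta>) \<le> C * M))"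

definition holo_on :: "(complex^'n \<Rightarrow> complex^'m) \<Rightarrow> (complex^'n) set \<Rightarrow> bool" where
  "holo_on g S \<longleftrightarrow>
     (\<forall>x\<in>S. \<exists>g'. (g has_derivative g') (at x) \<and> (\<forall>a v. g' (a *s v) = a *s g' v))"

definition complex_jacobian ::
    "(complex^'n \<Rightarrow> complex^'m) \<Rightarrow> complex^'n \<Rightarrow> complex^'n^'m" where
  "complex_jacobian g x = (\<chi> a j. frechet_derivative g (at x) (axis j 1) $ a)"

text \<open>The Wirtinger derivatives \<open>\<partial>/\<partial>z\<^sub>j\<close> and \<open>\<partial>/\<partial>(cnj z\<^sub>j)\<close>.\<close>

definition dz :: "'n \<Rightarrow> (complex^'n \<Rightarrow> complex) \<Rightarrow> complex^'n \<Rightarrow> complex" where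
  "dz j g x = (frechet_derivative g (at x) (axis j 1)
               - \<i> * frechet_derivative g (at x) (axis j \<i>)) / 2"

definition dzbar :: "'n \<Rightarrow> (complex^'n \<Rightarrow> complex) \<Rightarrow> complex^'n \<Rightarrow> complex" where
  "dzbar j g x = (frechet_derivative g (at x) (axis j 1)
                  + \<i> * frechet_derivative g (at x) (axis j \<i>)) / 2"


section \<open>Complex manifolds\<close>

text \<open>The manifold is the whole type \<open>'a\<close>. A chart is a pair of its domain and a coordinate
  map, whose values outside the domain are irrelevant.\<close>

type_synonym ('a, 'n) chart = "'a set \<times> ('a \<Rightarrow> complex^'n)"

abbreviation dom_of :: "('a, 'n) chart \<Rightarrow> 'a set" where
  "dom_of c \<equiv> fst c"

abbreviation img_of :: "('a, 'n) chart \<Rightarrow> (complex^'n) set" where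
  "img_of c \<equiv> snd c ` fst c"

definition chart_inv :: "('a, 'n) chart \<Rightarrow> complex^'n \<Rightarrow> 'a" where
  "chart_inv c = inv_into (fst c) (snd c)"

definition is_chart :: "('a::topological_space, 'n::finite) chart \<Rightarrow> bool" where
  "is_chart c \<longleftrightarrow> open (dom_of c) \<and> open (img_of c) \<and>
     homeomorphism (dom_of c) (img_of c) (snd c) (chart_inv c)"

definition transition ::
    "('a, 'n) chart \<Rightarrow> ('a, 'n) chart \<Rightarrow> complex^'n \<Rightarrow> complex^'n" where
  "transition c c' = snd c' \<circ> chart_inv c"

definition compatible :: "('a, 'n::finite) chart \<Rightarrow> ('a, 'n) chart \<Rightarrow> bool" where
  "compatible c c' \<longleftrightarrow>
     holo_on (transition c c') (snd c ` (dom_of c \<inter> dom_of c')) \<and>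
     holo_on (transition c' c) (snd c' ` (dom_of c \<inter> dom_of c'))"

text \<open>A complex structure is a maximal holomorphic atlas, so that its elements are all the
  holomorphic coordinate systems on open sets.\<close>

definition complex_structure :: "('a::topological_space, 'n::finite) chart set \<Rightarrow> bool" where
  "complex_structure \<A> \<longleftrightarrow>
     (\<forall>c\<in>\<A>. is_chart c) \<and>
     (\<Union>c\<in>\<A>. dom_of c) = UNIV \<and>
     (\<forall>c\<in>\<A>. \<forall>c'\<in>\<A>. compatible c c') \<and>
     (\<forall>c. is_chart c \<longrightarrow> (\<forall>c'\<in>\<A>. compatible c c') \<longrightarrow> c \<in> \<A>)"

definition holomorphic_map ::
    "('a::topological_space, 'n::finite) chart set \<Rightarrow> ('a \<Rightarrow> 'a) \<Rightarrow> bool" where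
  "holomorphic_map \<A> f \<longleftrightarrow> continuous_on UNIV f \<and>
     (\<forall>c\<in>\<A>. \<forall>c'\<in>\<A>.
        holo_on (snd c' \<circ> f \<circ> chart_inv c) (snd c ` (dom_of c \<inter> f -` dom_of c')))"

text \<open>A Kaehler form is given in each chart by the coefficient matrix \<open>h\<close> of
  \<open>\<i> \<Sum> h\<^sub>j\<^sub>k dz\<^sub>j \<and> d(cnj z\<^sub>k)\<close>. The conjuncts say that it is smooth, Hermitian and positive
  definite, that it is closed, and that it is a globally well-defined form.\<close>

definition kaehler_form ::
    "('a, 'n::finite) chart set \<Rightarrow> (('a, 'n) chart \<Rightarrow> complex^'n \<Rightarrow> complex^'n^'n) \<Rightarrow> bool" where
  "kaehler_form \<A> h \<longleftrightarrow>
     (\<forall>c\<in>\<A>. \<forall>j k. smooth_on (img_of c) (\<lambda>x. h c x $ j $ k)) \<and>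
     (\<forall>c\<in>\<A>. \<forall>x\<in>img_of c. \<forall>j k. h c x $ k $ j = cnj (h c x $ j $ k)) \<and>
     (\<forall>c\<in>\<A>. \<forall>x\<in>img_of c. \<forall>a. a \<noteq> 0 \<longrightarrow>
        0 < Re (\<Sum>j\<in>UNIV. \<Sum>k\<in>UNIV. h c x $ j $ k * a $ j * cnj (a $ k))) \<and>
     (\<forall>c\<in>\<A>. \<forall>x\<in>img_of c. \<forall>j k l.
        dz l (\<lambda>x. h c x $ j $ k) x = dz j (\<lambda>x. h c x $ l $ k) x) \<and>
     (\<forall>c\<in>\<A>. \<forall>c'\<in>\<A>. \<forall>x\<in>snd c ` (dom_of c \<inter> dom_of c'). \<forall>j k.
        h c x $ j $ k =
          (let J = complex_jacobian (transition c c') x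
           in \<Sum>a\<in>UNIV. \<Sum>b\<in>UNIV. h c' (transition c c' x) $ a $ b * J $ a $ j * cnj (J $ b $ k)))"

definition compact_kaehler_manifold :: "('a::t2_space, 'n::finite) chart set \<Rightarrow> bool" where
  "compact_kaehler_manifold \<A> \<longleftrightarrow>
     complex_structure \<A> \<and> compact (UNIV :: 'a set) \<and> (\<exists>h. kaehler_form \<A> h)"


section \<open>Currents of bidegree (1,1)\<close>

text \<open>A (1,1)-current is a (1,1)-form \<open>\<i> \<Sum> T\<^sub>j\<^sub>k dz\<^sub>j \<and> d(cnj z\<^sub>k)\<close> whose coefficients in each
  chart are distributions; functions act as distributions by integration against Lebesgue
  measure in the coordinates.\<close>

type_synonym 'n coeffs = "'n \<Rightarrow> 'n \<Rightarrow> (complex^'n \<Rightarrow> complex) \<Rightarrow> complex"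

type_synonym ('a, 'n) current = "('a, 'n) chart \<Rightarrow> 'n coeffs"

text \<open>The second conjunct is the transformation law of the coefficients of a (1,1)-form, for the
  coordinate change \<open>\<psi>\<close> from \<open>c\<close> to \<open>c'\<close> with complex Jacobian matrix \<open>J\<close>. For coefficients
  that are functions it reads \<open>T\<^sub>j\<^sub>k = \<Sum> (T'\<^sub>a\<^sub>b \<circ> \<psi>) J\<^sub>a\<^sub>j cnj J\<^sub>b\<^sub>k\<close>; integrating against
  a test function and substituting \<open>y = \<psi> x\<close> gives the formula below, the squared modulus of
  \<open>det J\<close> being the real Jacobian determinant of \<open>\<psi>\<close>.\<close>

definition current11 :: "('a, 'n::finite) chart set \<Rightarrow> ('a, 'n) current \<Rightarrow> bool" where
  "current11 \<A> T \<longleftrightarrow>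
     (\<forall>c\<in>\<A>. \<forall>j k. distribution_on (img_of c) (T c j k)) \<and>
     (\<forall>c\<in>\<A>. \<forall>c'\<in>\<A>. \<forall>j k \<theta>. test_fun (snd c ` (dom_of c \<inter> dom_of c')) \<theta> \<longrightarrow>
        T c j k \<theta> = (\<Sum>a\<in>UNIV. \<Sum>b\<in>UNIV. T c' a b
          (\<lambda>y. if y \<in> snd c' ` (dom_of c \<inter> dom_of c')
               then let x = transition c' c y; J = complex_jacobian (transition c c') x
                    in \<theta> x * J $ a $ j * cnj (J $ b $ k) / of_real ((cmod (det J))\<^sup>2)
               else 0)))"

definition real_current :: "('a, 'n::finite) chart set \<Rightarrow> ('a, 'n) current \<Rightarrow> bool" where
  "real_current \<A> T \<longleftrightarrow>
     (\<forall>c\<in>\<A>. \<forall>j k \<theta>. test_fun (img_of c) \<theta> \<longrightarrow> T c k j (\<lambda>x. cnj (\<theta> x)) = cnj (T c j k \<theta>))"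

text \<open>\<open>d T = 0\<close>, written as the vanishing of its (2,1) and (1,2) parts in terms of the coefficients.\<close>

definition closed_current :: "('a, 'n::finite) chart set \<Rightarrow> ('a, 'n) current \<Rightarrow> bool" where
  "closed_current \<A> T \<longleftrightarrow>
     (\<forall>c\<in>\<A>. \<forall>j k l \<theta>. test_fun (img_of c) \<theta> \<longrightarrow>
        T c j k (dz l \<theta>) = T c l k (dz j \<theta>) \<and>
        T c j k (dzbar l \<theta>) = T c j l (dzbar k \<theta>))"

text \<open>The current \<open>dd\<^sup>c u\<close>, normalized so that its coefficients are
  \<open>(1/\<pi>) \<partial>\<^sup>2u / \<partial>z\<^sub>j \<partial>(cnj z\<^sub>k)\<close>. It is meant for locally integrable \<open>u\<close>; on an upper
  semicontinuous function \<open>v\<close> with extended values it is used as \<open>ddc (real_of_ereal \<circ> v)\<close>,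
  the set \<open>v = -\<infinity>\<close> being null.\<close>

definition ddc :: "('a \<Rightarrow> real) \<Rightarrow> ('a, 'n::finite) current" where
  "ddc u c j k \<theta> =
     (LINT x:img_of c|lebesgue. of_real (u (chart_inv c x)) * dz j (dzbar k \<theta>) x) / of_real pi"

text \<open>\<open>S \<le> T\<close> means that \<open>T - S\<close> is positive: for every vector \<open>a\<close>, the distribution
  \<open>\<Sum> (T - S)\<^sub>j\<^sub>k a\<^sub>j cnj a\<^sub>k\<close> is nonnegative.\<close>

definition coeffs_le :: "('a, 'n::finite) chart \<Rightarrow> 'n coeffs \<Rightarrow> 'n coeffs \<Rightarrow> bool" where
  "coeffs_le c S T \<longleftrightarrow>
     (\<forall>\<theta> a. test_fun (img_of c) \<theta> \<longrightarrow> (\<forall>x. \<theta> x \<in> \<real>\<^sub>\<ge>\<^sub>0) \<longrightarrow>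
        (\<Sum>j\<in>UNIV. \<Sum>k\<in>UNIV. (T j k \<theta> - S j k \<theta>) * a $ j * cnj (a $ k)) \<in> \<real>\<^sub>\<ge>\<^sub>0)"

text \<open>\<open>\<omega> = dd\<^sup>c \<phi>\<^sub>i\<close> on \<open>U\<^sub>i\<close>, with \<open>\<phi>\<^sub>i\<close> continuous on \<open>U\<^sub>i\<close>, for a finite cover by
  coordinate neighborhoods.\<close>

definition continuous_local_potentials ::
    "('a::topological_space, 'n::finite) chart set \<Rightarrow> ('a, 'n) current \<Rightarrow>
     'i set \<Rightarrow> ('i \<Rightarrow> 'a set) \<Rightarrow> ('i \<Rightarrow> 'a \<Rightarrow> real) \<Rightarrow> bool" where
  "continuous_local_potentials \<A> \<omega> I U \<phi> \<longleftrightarrow>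
     finite I \<and> (\<Union>i\<in>I. U i) = UNIV \<and>
     (\<forall>i\<in>I. U i \<in> dom_of ` \<A> \<and> continuous_on (U i) (\<phi> i) \<and>
        (\<forall>c\<in>\<A>. dom_of c \<subseteq> U i \<longrightarrow>
           (\<forall>j k \<theta>. test_fun (img_of c) \<theta> \<longrightarrow> \<omega> c j k \<theta> = ddc (\<phi> i) c j k \<theta>)))"


section \<open>Quasi-plurisubharmonic functions\<close>

definition usc_on :: "'a::topological_space set \<Rightarrow> ('a \<Rightarrow> ereal) \<Rightarrow> bool" where
  "usc_on S u \<longleftrightarrow> (\<forall>a. openin (top_of_set S) {x \<in> S. u x < a})"

text \<open>Local integrability on the domain of a chart. On a compact manifold, a function is in
  \<open>L\<^sup>1\<close> (for any smooth volume form) iff this holds in every chart. Finiteness almost everywhere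
  is required explicitly because \<^const>\<open>real_of_ereal\<close> sends infinite values to \<open>0\<close>.\<close>

definition chart_L1_loc :: "('a, 'n::finite) chart \<Rightarrow> ('a \<Rightarrow> ereal) \<Rightarrow> bool" where
  "chart_L1_loc c u \<longleftrightarrow>
     (\<forall>L. compact L \<longrightarrow> L \<subseteq> img_of c \<longrightarrow>
        negligible {x \<in> L. \<bar>u (chart_inv c x)\<bar> = \<infinity>} \<and>
        (\<lambda>x. real_of_ereal (u (chart_inv c x))) absolutely_integrable_on L)"

definition PSH ::
    "('a::topological_space, 'n::finite) chart set \<Rightarrow> ('a, 'n) current \<Rightarrow> ('a \<Rightarrow> ereal) set" where
  "PSH \<A> \<omega> =
     {v. usc_on UNIV v \<and> (\<forall>x. v x \<noteq> \<infinity>) \<and> (\<forall>c\<in>\<A>. chart_L1_loc c v) \<and>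
         (\<forall>c\<in>\<A>. coeffs_le c (\<lambda>j k \<theta>. - \<omega> c j k \<theta>) (ddc (\<lambda>x. real_of_ereal (v x)) c))}"

text \<open>A set is pluripolar if near each of its points it is contained in the \<open>-\<infinity>\<close> set of a
  plurisubharmonic function that is not identically \<open>-\<infinity>\<close> on any component. Such a function on
  a coordinate neighborhood is upper semicontinuous, locally integrable, and satisfies
  \<open>dd\<^sup>c u \<ge> 0\<close>. Conversely, these conditions make \<open>u\<close> equal almost everywhere to a
  plurisubharmonic function below \<open>u\<close>, so they define the same pluripolar sets.\<close>

definition psh_on_chart :: "('a::topological_space, 'n::finite) chart \<Rightarrow> ('a \<Rightarrow> ereal) \<Rightarrow> bool" where
  "psh_on_chart c u \<longleftrightarrow>
     usc_on (dom_of c) u \<and> (\<forall>x\<in>dom_of c. u x \<noteq> \<infinity>) \<and> chart_L1_loc c u \<and>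
     coeffs_le c (\<lambda>j k \<theta>. 0) (ddc (\<lambda>x. real_of_ereal (u x)) c)"

definition pluripolar :: "('a::topological_space, 'n::finite) chart set \<Rightarrow> 'a set \<Rightarrow> bool" where
  "pluripolar \<A> A \<longleftrightarrow>
     (\<forall>p\<in>A. \<exists>c\<in>\<A>. p \<in> dom_of c \<and>
        (\<exists>u. psh_on_chart c u \<and> (\<forall>x \<in> A \<inter> dom_of c. u x = -\<infinity>)))"

text \<open>The weights \<open>exp (-Q + \<phi>\<^sub>i)\<close> are \<open>0\<close> where \<open>Q = \<infinity>\<close>.\<close>

definition mild ::
    "('a::topological_space, 'n::finite) chart set \<Rightarrow>
     'i set \<Rightarrow> ('i \<Rightarrow> 'a set) \<Rightarrow> ('i \<Rightarrow> 'a \<Rightarrow> real) \<Rightarrow> ('a \<Rightarrow> ereal) \<Rightarrow> bool" where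
  "mild \<A> I U \<phi> Q \<longleftrightarrow>
     (\<forall>x. Q x \<noteq> -\<infinity>) \<and>
     (\<forall>i\<in>I. continuous_on (U i)
        (\<lambda>x. if Q x = \<infinity> then 0 else exp (- real_of_ereal (Q x) + \<phi> i x))) \<and>
     \<not> pluripolar \<A> {x. Q x \<noteq> \<infinity>}"

definition green_function ::
    "('a::topological_space, 'n::finite) chart set \<Rightarrow> ('a, 'n) current \<Rightarrow>
     'a set \<Rightarrow> ('a \<Rightarrow> ereal) \<Rightarrow> 'a \<Rightarrow> ereal" where
  "green_function \<A> \<omega> K Q x = Sup {v x | v. v \<in> PSH \<A> \<omega> \<and> (\<forall>y\<in>K. v y \<le> Q y)}"

definition pushforward :: "('a \<Rightarrow> 'a) \<Rightarrow> ('a \<Rightarrow> ereal) \<Rightarrow> 'a \<Rightarrow> ereal" where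
  "pushforward f u x = Sup {u y | y. y \<in> f -` {x}}"

definition pullback :: "('a \<Rightarrow> 'a) \<Rightarrow> ('a \<Rightarrow> ereal) \<Rightarrow> 'a \<Rightarrow> ereal" where
  "pullback f u = u \<circ> f"

end

theory Submission
  imports Defs
begin

text \<open>Both inequalities come from transporting the competitors in the suprema that define the two
  Green functions. A competitor \<open>v\<close> for the weight \<open>f\<^sup>*Q / \<alpha>\<close> on \<open>f\<^sup>-\<^sup>1(K)\<close>
  is bounded by \<open>Q(y) / \<alpha>\<close> on the whole fibre over each \<open>y \<in> K\<close>, because \<open>f\<^sup>*Q\<close> is constant
  on fibres. Hence \<open>\<alpha> f\<^sub>*v\<close>, which is \<open>\<omega>\<close>-plurisubharmonic by hypothesis, competes for \<open>Q\<close>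
  on \<open>K\<close>, and its value at \<open>f(x)\<close> is at least \<open>\<alpha> v(x)\<close>
  (\<open>green_function_preimage_le\<close>). In the other direction, a
  competitor \<open>v\<close> for \<open>Q\<close> on \<open>K\<close> satisfies \<open>v \<circ> f = \<beta> u\<close> with \<open>u\<close>
  \<open>\<omega>\<close>-plurisubharmonic, and \<open>u\<close> competes for \<open>f\<^sup>*Q / \<beta>\<close> on \<open>f\<^sup>-\<^sup>1(K)\<close>
  (\<open>green_function_le_preimage\<close>).

  The suprema are taken in the extended reals, so they may be \<open>-\<infinity>\<close> (no competitor) or
  \<open>\<infinity>\<close>; multiplication by a positive real is an order isomorphism there, and no case has to be
  treated separately.\<close>

lemma green_function_upper:
  assumes "v \<in> PSH \<A> \<omega>" and "\<And>y. y \<in> K \<Longrightarrow> v y \<le> Q y"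
  shows "v x \<le> green_function \<A> \<omega> K Q x"
  unfolding green_function_def using assms by (intro Sup_upper) blast

lemma green_function_least:
  assumes "\<And>v. v \<in> PSH \<A> \<omega> \<Longrightarrow> (\<And>y. y \<in> K \<Longrightarrow> v y \<le> Q y) \<Longrightarrow> v x \<le> b"
  shows "green_function \<A> \<omega> K Q x \<le> b"
  unfolding green_function_def using assms by (intro Sup_least) blast

lemma pushforward_upper: "u x \<le> pushforward f u (f x)"
  unfolding pushforward_def by (intro Sup_upper) auto

lemma pushforward_le_iff: "pushforward f u y \<le> b \<longleftrightarrow> (\<forall>z. f z = y \<longrightarrow> u z \<le> b)"
  unfolding pushforward_def by (auto simp: Sup_le_iff)

text \<open>The supremum over a fibre preserves the bound by \<open>Q\<close>, so a competitor upstairs can be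
  pushed down at the cost of the factor \<open>\<alpha>\<close>.\<close>

lemma green_function_preimage_le:
  assumes "0 < \<alpha>"
    and push: "\<And>u. u \<in> PSH \<A> \<omega> \<Longrightarrow> (\<lambda>y. ereal \<alpha> * pushforward f u y) \<in> PSH \<A> \<omega>"
  shows "ereal \<alpha> * green_function \<A> \<omega> (f -` K) (\<lambda>y. pullback f Q y / ereal \<alpha>) x
           \<le> green_function \<A> \<omega> K Q (f x)"
proof -
  have scale: "s \<le> t / ereal \<alpha> \<longleftrightarrow> ereal \<alpha> * s \<le> t" for s t
    using \<open>0 < \<alpha>\<close> by (simp add: ereal_le_divide_pos)
  have "green_function \<A> \<omega> (f -` K) (\<lambda>y. pullback f Q y / ereal \<alpha>) x
          \<le> green_function \<A> \<omega> K Q (f x) / ereal \<alpha>"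
  proof (rule green_function_least)
    fix v assume v: "v \<in> PSH \<A> \<omega>"
      and le: "\<And>y. y \<in> f -` K \<Longrightarrow> v y \<le> pullback f Q y / ereal \<alpha>"
    have "ereal \<alpha> * pushforward f v y \<le> Q y" if "y \<in> K" for y
      using le that by (auto simp: scale[symmetric] pushforward_le_iff pullback_def)
    then have "ereal \<alpha> * pushforward f v (f x) \<le> green_function \<A> \<omega> K Q (f x)"
      by (rule green_function_upper[OF push[OF v]])
    then have "pushforward f v (f x) \<le> green_function \<A> \<omega> K Q (f x) / ereal \<alpha>"
      by (simp only: scale)
    then show "v x \<le> green_function \<A> \<omega> K Q (f x) / ereal \<alpha>"
      by (rule order_trans[OF pushforward_upper])
  qed
  then show ?thesis by (simp only: scale)
qed

text \<open>Composition with \<open>f\<close> preserves the bound by the weight, so a competitor downstairs can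
  be pulled back; dividing by \<open>\<beta>\<close> brings it back into the \<open>\<omega>\<close>-plurisubharmonic class.\<close>

lemma green_function_le_preimage:
  assumes "0 < \<beta>"
    and pull: "\<And>v. v \<in> PSH \<A> \<omega> \<Longrightarrow> \<exists>u \<in> PSH \<A> \<omega>. pullback f v = (\<lambda>y. ereal \<beta> * u y)"
  shows "green_function \<A> \<omega> K Q (f x)
           \<le> ereal \<beta> * green_function \<A> \<omega> (f -` K) (\<lambda>y. pullback f Q y / ereal \<beta>) x"
proof (rule green_function_least)
  fix v assume "v \<in> PSH \<A> \<omega>" and le: "\<And>y. y \<in> K \<Longrightarrow> v y \<le> Q y"
  then obtain u where u: "u \<in> PSH \<A> \<omega>" and "pullback f v = (\<lambda>y. ereal \<beta> * u y)"
    using pull by blast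
  then have vf: "v (f y) = ereal \<beta> * u y" for y
    by (simp add: pullback_def fun_eq_iff)
  have "u y \<le> pullback f Q y / ereal \<beta>" if "y \<in> f -` K" for y
    using le[of "f y"] that \<open>0 < \<beta>\<close> by (simp add: ereal_le_divide_pos pullback_def vf)
  then have "u x \<le> green_function \<A> \<omega> (f -` K) (\<lambda>y. pullback f Q y / ereal \<beta>) x"
    by (rule green_function_upper[OF u])
  then show "v (f x) \<le> ereal \<beta> * green_function \<A> \<omega> (f -` K) (\<lambda>y. pullback f Q y / ereal \<beta>) x"
    using \<open>0 < \<beta>\<close> by (simp add: vf ereal_mult_left_mono)
qed

theorem theorem5:
  fixes \<A> :: "('a::t2_space, 'n::finite) chart set"
    and \<omega> :: "('a, 'n) current"
    and I :: "'i set" and U :: "'i \<Rightarrow> 'a set" and \<phi> :: "'i \<Rightarrow> 'a \<Rightarrow> real"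
    and f :: "'a \<Rightarrow> 'a" and \<alpha> \<beta> :: real
    and K :: "'a set" and Q :: "'a \<Rightarrow> ereal" and x :: 'a
  assumes "compact_kaehler_manifold \<A>"
    and "connected (UNIV :: 'a set)"
    and "current11 \<A> \<omega>" "real_current \<A> \<omega>" "closed_current \<A> \<omega>"
    and "continuous_local_potentials \<A> \<omega> I U \<phi>"
    and "holomorphic_map \<A> f" "surj f"
    and "1 < \<alpha>" "\<alpha> \<le> \<beta>"
    and "{(\<lambda>y. ereal \<alpha> * pushforward f u y) | u. u \<in> PSH \<A> \<omega>} \<subseteq> PSH \<A> \<omega>"
    and "{pullback f u | u. u \<in> PSH \<A> \<omega>} \<subseteq> {(\<lambda>y. ereal \<beta> * u y) | u. u \<in> PSH \<A> \<omega>}"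
    and "K \<in> sets borel"
    and "mild \<A> I U \<phi> Q"
  shows "ereal \<alpha> * green_function \<A> \<omega> (f -` K) (\<lambda>y. pullback f Q y / ereal \<alpha>) x
           \<le> green_function \<A> \<omega> K Q (f x) \<and>
         green_function \<A> \<omega> K Q (f x)
           \<le> ereal \<beta> * green_function \<A> \<omega> (f -` K) (\<lambda>y. pullback f Q y / ereal \<beta>) x"
proof
  show "ereal \<alpha> * green_function \<A> \<omega> (f -` K) (\<lambda>y. pullback f Q y / ereal \<alpha>) x
          \<le> green_function \<A> \<omega> K Q (f x)"
    by (rule green_function_preimage_le) (use assms(9,11) in auto)
  show "green_function \<A> \<omega> K Q (f x)
          \<le> ereal \<beta> * green_function \<A> \<omega> (f -` K) (\<lambda>y. pullback f Q y / ereal \<beta>) x"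
    by (rule green_function_le_preimage) (use assms(9,10,12) in auto)
qed

end
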